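(* Let $G=(V,E)$ be a connected simple graph on $n$ vertices, and equip it with the minimum degree conductance function $c(u,v)=\frac{1}{\min[d(u),d(v)]}$ for every edge $(u,v)\in E$. Then the cyclic cover time of the associated random walk satisfies $CYC[G,c]\le 18n^2$.
   Context: For a vertex $v$, $d(v)$ is its degree and $N(v)$ its set of neighbors. Given a connected graph $G$ and a conductance function $c:E\to\mathbb{R}_{\ge 0}$ (such that the edges of positive conductance form a connected spanning subgraph), the associated random walk is the Markov chain on $V$ which from the current vertex $v$ moves to $u\in N(v)$ with probability $\frac{c(v,u)}{\sum_{w\in N(v)}c(v,w)}$. For vertices $u,v$, the hitting time $H[u,v]$ is the expected number of steps for the walk started at $u$ to reach $v$. The cyclic cover time is $CYC[G,c]=\min_{\sigma}\left(H[v_{\sigma(1)},v_{\sigma(2)}]+\dots+H[v_{\sigma(n-1)},v_{\sigma(n)}]+H[v_{\sigma(n)},v_{\sigma(1)}]\right)$, the minimum over all orderings $\sigma$ of the vertices $v_1,\dots,v_n$. *)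

theory Defs
  imports Complex_Main
begin

definition simple_graph :: "'a set \<Rightarrow> ('a \<Rightarrow> 'a \<Rightarrow> bool) \<Rightarrow> bool" where
  "simple_graph V E \<longleftrightarrow> finite V \<and> (\<forall>u v. E u v \<longrightarrow> u \<in> V \<and> v \<in> V) \<and>
     (\<forall>u v. E u v \<longrightarrow> E v u) \<and> (\<forall>v. \<not> E v v)"

definition connected_graph :: "'a set \<Rightarrow> ('a \<Rightarrow> 'a \<Rightarrow> bool) \<Rightarrow> bool" where
  "connected_graph V E \<longleftrightarrow> V \<noteq> {} \<and> (\<forall>u\<in>V. \<forall>v\<in>V. E\<^sup>*\<^sup>* u v)"

definition nbrs :: "'a set \<Rightarrow> ('a \<Rightarrow> 'a \<Rightarrow> bool) \<Rightarrow> 'a \<Rightarrow> 'a set" where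
  "nbrs V E v = {u \<in> V. E v u}"

definition deg :: "'a set \<Rightarrow> ('a \<Rightarrow> 'a \<Rightarrow> bool) \<Rightarrow> 'a \<Rightarrow> nat" where
  "deg V E v = card (nbrs V E v)"

definition rw_trans :: "'a set \<Rightarrow> ('a \<Rightarrow> 'a \<Rightarrow> bool) \<Rightarrow> ('a \<Rightarrow> 'a \<Rightarrow> real) \<Rightarrow> 'a \<Rightarrow> 'a \<Rightarrow> real" where
  "rw_trans V E c v u =
     (if E v u then c v u / (\<Sum>w\<in>nbrs V E v. c v w) else 0)"

text \<open>Probability that the chain with transition matrix P started at x has not visited
  the target v during steps 0..t, i.e. P(T_v > t).\<close>

fun not_hit :: "'a set \<Rightarrow> ('a \<Rightarrow> 'a \<Rightarrow> real) \<Rightarrow> 'a \<Rightarrow> nat \<Rightarrow> 'a \<Rightarrow> real" where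
  "not_hit V P v 0 x = (if x = v then 0 else 1)"
| "not_hit V P v (Suc t) x = (if x = v then 0 else (\<Sum>y\<in>V. P x y * not_hit V P v t y))"

text \<open>Hitting time H[u,v] = E[T_v] = sum over t of P(T_v > t).\<close>

definition hitting_time :: "'a set \<Rightarrow> ('a \<Rightarrow> 'a \<Rightarrow> real) \<Rightarrow> 'a \<Rightarrow> 'a \<Rightarrow> real" where
  "hitting_time V P u v = (\<Sum>t. not_hit V P v t u)"

definition cyclic_sum :: "'a set \<Rightarrow> ('a \<Rightarrow> 'a \<Rightarrow> real) \<Rightarrow> 'a list \<Rightarrow> real" where
  "cyclic_sum V P xs =
     (\<Sum>i<length xs. hitting_time V P (xs ! i) (xs ! ((i + 1) mod length xs)))"

definition cyclic_cover_time :: "'a set \<Rightarrow> ('a \<Rightarrow> 'a \<Rightarrow> real) \<Rightarrow> real" where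
  "cyclic_cover_time V P =
     Min {cyclic_sum V P xs | xs. distinct xs \<and> set xs = V}"

definition min_deg_conductance :: "'a set \<Rightarrow> ('a \<Rightarrow> 'a \<Rightarrow> bool) \<Rightarrow> 'a \<Rightarrow> 'a \<Rightarrow> real" where
  "min_deg_conductance V E u v = 1 / real (min (deg V E u) (deg V E v))"

end

(* Let S be the sum of all conductances over ordered adjacent pairs; here S <= 2n. With H the
   hitting time, reversibility gives the sum of c(v,u) H(u,v) over u as S - c(v), which bounds
   H(u,v) by S min(d(u),d(v)) on edges and, summed over v, yields a Foster-type bound. A closed
   tour of length at most the weight of a minimum spanning tree exists, for the commute times as
   edge weights, by the triangle inequality. After scaling commute times by 1/(2S) to rho, the
   weight of that tree is the integral over r of the number, minus one, of components of the graph
   of edges with rho <= r. A component other than V contains a vertex v of degree more than r;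
   taking v of maximal degree, its neighbours outside the component are joined to v by edges
   with rho > r, which Foster's bound pays for (n in total), and each neighbour x inside pays
   1/d(v) from its budget, 1/d(x) per unit of r while r < d(x), and then 1/D(x) while r < D(x),
   where D(x) is the largest degree of a neighbour of x. Budgets total at most 2 per vertex, so
   the tree has weight at most 3n, and the tour has length at most 2S * 3n <= 12 n^2. *)

theory Submission
  imports Defs
begin

section \<open>Hitting times of a reversible walk\<close>

locale conductance_network =
  fixes V :: "'a set" and E :: "'a \<Rightarrow> 'a \<Rightarrow> bool" and c :: "'a \<Rightarrow> 'a \<Rightarrow> real"
  assumes graph: "simple_graph V E" and conn: "connected_graph V E"
    and c_sym: "c u v = c v u" and c_pos: "E u v \<Longrightarrow> c u v > 0"
begin

text \<open>\<open>c\<close> may be nonzero off the edges; cutting it to zero there lets all sums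
  run over \<open>V\<close> and be swapped freely.\<close>

definition weight :: "'a \<Rightarrow> 'a \<Rightarrow> real" where
  "weight u v = (if E u v then c u v else 0)"

definition strength :: "'a \<Rightarrow> real" where
  "strength v = (\<Sum>w\<in>V. weight v w)"

definition total_strength :: real where
  "total_strength = (\<Sum>v\<in>V. strength v)"

abbreviation P :: "'a \<Rightarrow> 'a \<Rightarrow> real" where "P \<equiv> rw_trans V E c"

abbreviation H :: "'a \<Rightarrow> 'a \<Rightarrow> real" where "H \<equiv> hitting_time V P"

text \<open>The expectation of min(T_v, t) for the walk from \<open>u\<close>. Being finite, it can
  be manipulated before the hitting time series is known to converge.\<close>

definition part_hit :: "'a \<Rightarrow> nat \<Rightarrow> 'a \<Rightarrow> real" where
  "part_hit v t u = (\<Sum>i<t. not_hit V P v i u)"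

lemma finV: "finite V"
  using graph by (simp add: simple_graph_def)

lemma E_V: "E u v \<Longrightarrow> u \<in> V" "E u v \<Longrightarrow> v \<in> V"
  using graph by (auto simp: simple_graph_def)

lemma E_sym: "E u v \<Longrightarrow> E v u"
  using graph by (auto simp: simple_graph_def)

lemma weight_sym: "weight u v = weight v u"
  using c_sym[of u v] E_sym by (auto simp: weight_def)

lemma weight_nonneg: "weight u v \<ge> 0"
  using c_pos by (auto simp: weight_def intro: less_imp_le)

lemma strength_nonneg: "strength v \<ge> 0"
  by (simp add: strength_def sum_nonneg weight_nonneg)

lemma strength_eq: "strength v = (\<Sum>w\<in>nbrs V E v. c v w)"
  unfolding strength_def nbrs_def weight_def
  by (simp add: sum.inter_filter finV)

lemma strength_pos:
  assumes "E u v" shows "strength u > 0"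
proof -
  have "0 < weight u v" using assms c_pos by (simp add: weight_def)
  also have "weight u v \<le> strength u"
    unfolding strength_def using E_V(2)[OF assms] finV
    by (intro member_le_sum) (auto simp: weight_nonneg)
  finally show ?thesis .
qed

lemma P_eq: "P u v = weight u v / strength u"
  by (simp add: rw_trans_def weight_def strength_eq)

lemma P_nonneg: "P u v \<ge> 0"
  by (simp add: P_eq weight_nonneg strength_nonneg)

lemma P_pos: "E u v \<Longrightarrow> P u v > 0"
  using strength_pos c_pos by (simp add: P_eq weight_def)

text \<open>Detailed balance: the right-hand side is symmetric, so \<open>strength\<close> is a
  reversible measure.\<close>

lemma strength_P: "strength u * P u v = weight u v"
proof (cases "E u v")
  case True
  then show ?thesis using strength_pos[OF True] by (simp add: P_eq)
qed (simp add: P_eq weight_def)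

text \<open>Not an equality: at a vertex without edges the row sum is 0, by division by
  zero.\<close>

lemma P_sum_le: "(\<Sum>v\<in>V. P u v) \<le> 1"
proof -
  have "(\<Sum>v\<in>V. P u v) = strength u / strength u"
    by (simp add: P_eq strength_def flip: sum_divide_distrib)
  then show ?thesis by simp
qed

section \<open>Truncated hitting times\<close>

lemma not_hit_nonneg: "not_hit V P v t u \<ge> 0"
  by (induction t arbitrary: u) (auto intro!: sum_nonneg mult_nonneg_nonneg P_nonneg)

lemma not_hit_target: "not_hit V P v t v = 0"
  by (cases t) auto

lemma part_hit_target: "part_hit v t v = 0"
  by (simp add: part_hit_def not_hit_target)

lemma part_hit_nonneg: "part_hit v t u \<ge> 0"
  by (simp add: part_hit_def sum_nonneg not_hit_nonneg)

lemma part_hit_mono: "part_hit v t u \<le> part_hit v (Suc t) u"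
  by (simp add: part_hit_def not_hit_nonneg)

lemma part_hit_Suc:
  assumes "u \<noteq> v"
  shows "part_hit v (Suc t) u = 1 + (\<Sum>y\<in>V. P u y * part_hit v t y)"
proof -
  have "part_hit v (Suc t) u = 1 + (\<Sum>i<t. \<Sum>y\<in>V. P u y * not_hit V P v i y)"
    unfolding part_hit_def sum.lessThan_Suc_shift using assms by simp
  also have "(\<Sum>i<t. \<Sum>y\<in>V. P u y * not_hit V P v i y) = (\<Sum>y\<in>V. P u y * part_hit v t y)"
    unfolding part_hit_def sum_distrib_left by (rule sum.swap)
  finally show ?thesis .
qed

text \<open>Invariance of the measure \<open>strength\<close> under one step of the walk, from
  detailed balance.\<close>

lemma sum_strength_P:
  "(\<Sum>u\<in>V. strength u * (\<Sum>y\<in>V. P u y * g y)) = (\<Sum>y\<in>V. strength y * g y)"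
proof -
  have "(\<Sum>u\<in>V. strength u * (\<Sum>y\<in>V. P u y * g y)) = (\<Sum>u\<in>V. \<Sum>y\<in>V. weight y u * g y)"
    by (simp add: sum_distrib_left mult.assoc[symmetric] strength_P weight_sym)
  also have "\<dots> = (\<Sum>y\<in>V. \<Sum>u\<in>V. weight y u * g y)" by (rule sum.swap)
  finally show ?thesis by (simp add: strength_def sum_distrib_right)
qed

text \<open>Summing the first-step equations against the reversible measure telescopes; only the
  equation at the target is missing.\<close>

lemma sum_first_step:
  assumes v: "v \<in> V" and g0: "g' v = 0"
    and step: "\<And>u. u \<in> V \<Longrightarrow> u \<noteq> v \<Longrightarrow> g' u = 1 + (\<Sum>y\<in>V. P u y * g y)"
  shows "(\<Sum>u\<in>V. strength u * g' u) + (\<Sum>y\<in>V. weight v y * g y)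
    = total_strength - strength v + (\<Sum>u\<in>V. strength u * g u)"
proof -
  have fin: "finite V" by (rule finV)
  have "(\<Sum>u\<in>V. strength u * g' u) = (\<Sum>u\<in>V-{v}. strength u * g' u)"
    using sum.remove[OF fin v, of "\<lambda>u. strength u * g' u"] g0 by simp
  also have "\<dots> = (\<Sum>u\<in>V-{v}. strength u + strength u * (\<Sum>y\<in>V. P u y * g y))"
    by (rule sum.cong) (auto simp: step algebra_simps)
  also have "\<dots> = (\<Sum>u\<in>V-{v}. strength u) + (\<Sum>u\<in>V-{v}. strength u * (\<Sum>y\<in>V. P u y * g y))"
    by (rule sum.distrib)
  also have "(\<Sum>u\<in>V-{v}. strength u) = total_strength - strength v"
    unfolding total_strength_def using sum.remove[OF fin v, of strength] by simp
  also have "(\<Sum>u\<in>V-{v}. strength u * (\<Sum>y\<in>V. P u y * g y))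
    = (\<Sum>u\<in>V. strength u * g u) - strength v * (\<Sum>y\<in>V. P v y * g y)"
    using sum.remove[OF fin v, of "\<lambda>u. strength u * (\<Sum>y\<in>V. P u y * g y)"] sum_strength_P[of g]
    by simp
  also have "strength v * (\<Sum>y\<in>V. P v y * g y) = (\<Sum>y\<in>V. weight v y * g y)"
    by (simp add: sum_distrib_left mult.assoc[symmetric] strength_P)
  finally show ?thesis by simp
qed

text \<open>Monotonicity in \<open>t\<close> turns the balance of two consecutive truncations into a
  bound uniform in \<open>t\<close>.\<close>

lemma part_hit_sum_le:
  assumes v: "v \<in> V"
  shows "(\<Sum>y\<in>V. weight v y * part_hit v t y) \<le> total_strength - strength v"
proof -
  have "(\<Sum>u\<in>V. strength u * part_hit v t u) \<le> (\<Sum>u\<in>V. strength u * part_hit v (Suc t) u)"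
    by (intro sum_mono mult_left_mono part_hit_mono strength_nonneg)
  with sum_first_step[OF v, of "part_hit v (Suc t)" "part_hit v t"]
  show ?thesis by (simp add: part_hit_target part_hit_Suc)
qed

text \<open>The bound is carried along a path starting at \<open>v\<close>: a single term of a sum
  of nonnegative terms is at most the whole sum.\<close>

lemma part_hit_bounded:
  assumes u: "u \<in> V" and v: "v \<in> V"
  shows "\<exists>B. \<forall>t. part_hit v t u \<le> B"
proof -
  have "E\<^sup>*\<^sup>* v u" using conn u v by (auto simp: connected_graph_def)
  then show ?thesis
  proof (induction rule: rtranclp_induct)
    case base
    show ?case by (auto simp: part_hit_target)
  next
    case (step x u)
    show ?case
    proof (cases "x = v")
      \<comment> \<open>No first-step equation holds at the target, so the first edge of the path
        uses \<open>part_hit_sum_le\<close> instead.\<close>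
      case True
      have w: "weight v u > 0" using step True c_pos by (simp add: weight_def)
      have "part_hit v t u \<le> (total_strength - strength v) / weight v u" for t
      proof -
        have "weight v u * part_hit v t u \<le> (\<Sum>y\<in>V. weight v y * part_hit v t y)"
          using finV E_V(2)[OF step(2)]
          by (intro member_le_sum) (auto intro!: mult_nonneg_nonneg weight_nonneg part_hit_nonneg)
        also have "\<dots> \<le> total_strength - strength v" by (rule part_hit_sum_le[OF v])
        finally show ?thesis using w by (simp add: field_simps)
      qed
      then show ?thesis by blast
    next
      case False
      from step.IH obtain B where B: "part_hit v t x \<le> B" for t by blast
      have p: "P x u > 0" using step P_pos by simp
      have "part_hit v t u \<le> B / P x u" for t
      proof -
        have "P x u * part_hit v t u \<le> (\<Sum>y\<in>V. P x y * part_hit v t y)"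
          using finV E_V(2)[OF step(2)]
          by (intro member_le_sum) (auto intro!: mult_nonneg_nonneg P_nonneg part_hit_nonneg)
        also have "\<dots> \<le> part_hit v (Suc t) x" using part_hit_Suc[OF False, of t] by simp
        also have "\<dots> \<le> B" by (rule B)
        finally show ?thesis using p by (simp add: field_simps)
      qed
      then show ?thesis by blast
    qed
  qed
qed

section \<open>Passage to the limit: equations for hitting times\<close>

lemma not_hit_summable:
  assumes "u \<in> V" "v \<in> V" shows "summable (\<lambda>t. not_hit V P v t u)"
proof -
  obtain B where B: "part_hit v t u \<le> B" for t using part_hit_bounded[OF assms] by blast
  show ?thesis
  proof (rule bounded_imp_summable)
    show "(\<Sum>k\<le>t. not_hit V P v k u) \<le> B" for t
      using B[of "Suc t"] by (simp add: part_hit_def lessThan_Suc_atMost)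
  qed (rule not_hit_nonneg)
qed

lemma part_hit_tendsto:
  assumes "u \<in> V" "v \<in> V" shows "(\<lambda>t. part_hit v t u) \<longlonglongrightarrow> H u v"
  using summable_LIMSEQ[OF not_hit_summable[OF assms]]
  by (simp add: part_hit_def hitting_time_def)

lemma H_self: "H v v = 0"
  by (simp add: hitting_time_def not_hit_target)

lemma H_nonneg:
  assumes "u \<in> V" "v \<in> V" shows "H u v \<ge> 0"
  unfolding hitting_time_def by (intro suminf_nonneg not_hit_summable assms not_hit_nonneg)

lemma H_step:
  assumes u: "u \<in> V" and v: "v \<in> V" and ne: "u \<noteq> v"
  shows "H u v = 1 + (\<Sum>y\<in>V. P u y * H y v)"
proof -
  have "(\<lambda>t. part_hit v (Suc t) u) \<longlonglongrightarrow> H u v"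
    by (rule LIMSEQ_Suc[OF part_hit_tendsto[OF u v]])
  moreover have "(\<lambda>t. part_hit v (Suc t) u) \<longlonglongrightarrow> 1 + (\<Sum>y\<in>V. P u y * H y v)"
    unfolding part_hit_Suc[OF ne] by (intro tendsto_intros part_hit_tendsto v)
  ultimately show ?thesis by (rule LIMSEQ_unique)
qed

text \<open>By induction on \<open>t\<close>, the function \<open>H u v + H v w\<close> of
  \<open>u\<close> dominates \<open>part_hit w t u\<close>: away from \<open>v\<close> and
  \<open>w\<close> both obey a first-step equation, and at \<open>v\<close> it equals the limit
  \<open>H v w\<close>.\<close>

lemma H_triangle:
  assumes u: "u \<in> V" and v: "v \<in> V" and w: "w \<in> V"
  shows "H u w \<le> H u v + H v w"
proof -
  have vw: "part_hit w t v \<le> H v w" for t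
  proof -
    have "incseq (\<lambda>t. part_hit w t v)" by (intro incseq_SucI part_hit_mono)
    then show ?thesis by (rule incseq_le[OF _ part_hit_tendsto[OF v w]])
  qed
  have "part_hit w t u \<le> H u v + H v w" if "u \<in> V" for t u
    using that
  proof (induction t arbitrary: u)
    case 0
    then show ?case using H_nonneg v w by (simp add: part_hit_def)
  next
    case (Suc t)
    consider "u = w" | "u = v" | "u \<noteq> w" "u \<noteq> v" by blast
    then show ?case
    proof cases
      case 1
      then show ?thesis using H_nonneg v w by (simp add: part_hit_target)
    next
      case 2
      then show ?thesis using vw by (simp add: H_self)
    next
      case 3
      have "(\<Sum>y\<in>V. P u y * part_hit w t y) \<le> (\<Sum>y\<in>V. P u y * (H y v + H v w))"
        by (intro sum_mono mult_left_mono Suc.IH P_nonneg)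
      also have "\<dots> = (\<Sum>y\<in>V. P u y * H y v) + (\<Sum>y\<in>V. P u y) * H v w"
        by (simp add: distrib_left sum.distrib sum_distrib_right)
      also have "(\<Sum>y\<in>V. P u y) * H v w \<le> 1 * H v w"
        by (intro mult_right_mono P_sum_le H_nonneg v w)
      finally show ?thesis
        using H_step[OF Suc.prems v 3(2)] part_hit_Suc[OF 3(1), of t] by simp
    qed
  qed
  then show ?thesis using u by (intro LIMSEQ_le_const2[OF part_hit_tendsto[OF u w]]) auto
qed

text \<open>Kac's formula: the mean return time to \<open>v\<close> times \<open>strength v\<close>
  is \<open>total_strength\<close>, and the first step of the excursion accounts for the subtracted
  term.\<close>

lemma H_return:
  assumes v: "v \<in> V"
  shows "(\<Sum>y\<in>V. weight v y * H y v) = total_strength - strength v"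
  using sum_first_step[OF v, of "\<lambda>u. H u v" "\<lambda>u. H u v"] by (simp add: H_self H_step v)

lemma H_edge:
  assumes e: "E u v" shows "c u v * H u v \<le> total_strength"
proof -
  have uv: "u \<in> V" "v \<in> V" using E_V e by auto
  have "c u v * H u v = weight v u * H u v" using e E_sym c_sym by (simp add: weight_def)
  also have "\<dots> \<le> (\<Sum>y\<in>V. weight v y * H y v)"
    using uv finV by (intro member_le_sum) (auto intro!: mult_nonneg_nonneg weight_nonneg H_nonneg)
  finally show ?thesis using H_return[OF uv(2)] strength_nonneg[of v] by simp
qed

text \<open>Summing \<open>H_return\<close> over \<open>v\<close> gives each of the two directions
  of the commute time; the exact value has \<open>card V - 1\<close> in place of
  \<open>card V\<close>.\<close>

lemma Foster:
  "(\<Sum>v\<in>V. \<Sum>u\<in>nbrs V E v. c v u * (H v u + H u v)) \<le> 2 * total_strength * real (card V)"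
proof -
  have "(\<Sum>v\<in>V. \<Sum>u\<in>nbrs V E v. c v u * (H v u + H u v))
      = (\<Sum>v\<in>V. \<Sum>u\<in>V. weight v u * (H v u + H u v))"
    unfolding nbrs_def by (auto simp: sum.inter_filter finV weight_def intro!: sum.cong)
  also have "\<dots> = (\<Sum>v\<in>V. \<Sum>u\<in>V. weight v u * H v u) + (\<Sum>v\<in>V. \<Sum>u\<in>V. weight v u * H u v)"
    by (simp add: distrib_left sum.distrib)
  also have "(\<Sum>v\<in>V. \<Sum>u\<in>V. weight v u * H v u) = (\<Sum>u\<in>V. \<Sum>v\<in>V. weight u v * H v u)"
    by (subst sum.swap) (simp add: weight_sym)
  also have "\<dots> + (\<Sum>v\<in>V. \<Sum>u\<in>V. weight v u * H u v) = 2 * (\<Sum>v\<in>V. total_strength - strength v)"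
    by (simp add: H_return)
  also have "\<dots> \<le> 2 * (\<Sum>v\<in>V. total_strength)"
    by (intro mult_left_mono sum_mono) (auto simp: strength_nonneg)
  finally show ?thesis by (simp add: algebra_simps)
qed

end

section \<open>Closed tours\<close>

fun walk_length :: "('a \<Rightarrow> 'a \<Rightarrow> real) \<Rightarrow> 'a list \<Rightarrow> real" where
  "walk_length h (x # y # xs) = h x y + walk_length h (y # xs)"
| "walk_length h _ = 0"

definition tour_length :: "('a \<Rightarrow> 'a \<Rightarrow> real) \<Rightarrow> 'a list \<Rightarrow> real" where
  "tour_length h xs = walk_length h (xs @ [hd xs])"

lemma walk_length_append:
  "walk_length h (as @ u # bs) = walk_length h (as @ [u]) + walk_length h (u # bs)"
proof (induction as)
  case (Cons a as)
  then show ?case by (cases as) auto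
qed simp

lemma tour_length_rotate: "tour_length h (as @ u # bs) = tour_length h (u # bs @ as)"
proof (cases as)
  case (Cons a as')
  have "tour_length h (as @ u # bs) = walk_length h (as @ [u]) + walk_length h ((u # bs) @ [a])"
    using walk_length_append[of h as u "bs @ [a]"] Cons by (simp add: tour_length_def)
  moreover have "tour_length h (u # bs @ as) = walk_length h ((u # bs) @ [a]) + walk_length h (as @ [u])"
    using walk_length_append[of h "u # bs" a "as' @ [u]"] Cons by (simp add: tour_length_def)
  ultimately show ?thesis by simp
qed simp

lemma walk_length_conv_sum:
  "walk_length h xs = (\<Sum>i<length xs - 1. h (xs ! i) (xs ! Suc i))"
proof (induction h xs rule: walk_length.induct)
  case (1 h x y xs)
  then show ?case by (simp add: sum.lessThan_Suc_shift del: sum.lessThan_Suc)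
qed simp_all

lemma cyclic_sum_eq_tour_length:
  assumes "xs \<noteq> []"
  shows "cyclic_sum V P xs = tour_length (hitting_time V P) xs"
proof -
  have "xs ! (Suc i mod length xs) = (xs @ [hd xs]) ! Suc i" if "i < length xs" for i
  proof (cases "Suc i = length xs")
    case True
    then show ?thesis using assms by (simp add: hd_conv_nth nth_append)
  next
    case False
    then show ?thesis using that by (simp add: nth_append)
  qed
  then show ?thesis
    unfolding cyclic_sum_def tour_length_def walk_length_conv_sum
    by (auto simp: nth_append intro!: sum.cong)
qed

lemma walk_length_scale: "walk_length (\<lambda>u v. a * h u v) xs = a * walk_length h xs"
  by (induction h xs rule: walk_length.induct) (simp_all add: algebra_simps)

text \<open>Rotate the tours to start at \<open>u\<close> and \<open>v\<close>, go from
  \<open>u\<close> to \<open>v\<close>, around the second tour, then on to the successor of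
  \<open>u\<close>. The triangle inequality replaces this last jump by closing at \<open>v\<close>,
  returning to \<open>u\<close> and moving on.\<close>

lemma tour_merge:
  assumes tri: "\<And>u v w. u \<in> V \<Longrightarrow> v \<in> V \<Longrightarrow> w \<in> V \<Longrightarrow> h u w \<le> h u v + h v w"
    and self: "\<And>u. u \<in> V \<Longrightarrow> h u u = 0"
    and sub: "set xs \<subseteq> V" "set ys \<subseteq> V"
    and dist: "distinct xs" "distinct ys" "set xs \<inter> set ys = {}"
    and u: "u \<in> set xs" and v: "v \<in> set ys"
  obtains zs where "distinct zs" "set zs = set xs \<union> set ys"
    "tour_length h zs \<le> tour_length h xs + tour_length h ys + (h u v + h v u)"
proof -
  obtain as1 as2 where xs: "xs = as1 @ u # as2" using u by (meson split_list)
  obtain bs1 bs2 where ys: "ys = bs1 @ v # bs2" using v by (meson split_list)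
  define as where "as = as2 @ as1"
  define bs where "bs = bs2 @ bs1"
  have tx: "tour_length h xs = walk_length h ((u # as) @ [u])"
    unfolding xs tour_length_rotate as_def by (simp add: tour_length_def)
  have ty: "tour_length h ys = walk_length h ((v # bs) @ [v])"
    unfolding ys tour_length_rotate bs_def by (simp add: tour_length_def)
  have uV: "u \<in> V" and vV: "v \<in> V" using u v sub by auto
  have redirect: "walk_length h ((v # bs) @ [a]) \<le> walk_length h ((v # bs) @ [v]) + h v a"
    if a: "a \<in> V" for a
  proof -
    obtain ws z where ws: "v # bs = ws @ [z]" by (metis rev_exhaust list.distinct(1))
    then have "z \<in> set (v # bs)" by simp
    then have "z \<in> V" using sub(2) by (auto simp: ys bs_def)
    then have "h z a \<le> h z v + h v a" using tri vV a by blast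
    then show ?thesis
      unfolding ws using walk_length_append[of h ws z "[a]"] walk_length_append[of h ws z "[v]"]
      by simp
  qed
  show ?thesis
  proof
    let ?zs = "u # v # bs @ as"
    show "distinct ?zs" using dist by (auto simp: xs ys as_def bs_def)
    show "set ?zs = set xs \<union> set ys" by (auto simp: xs ys as_def bs_def)
    show "tour_length h ?zs \<le> tour_length h xs + tour_length h ys + (h u v + h v u)"
    proof (cases as)
      case Nil
      \<comment> \<open>With \<open>u\<close> alone in its tour, the jump ends at \<open>u\<close>
        itself, and the old tour cost \<open>h u u = 0\<close>.\<close>
      then show ?thesis using redirect[OF uV] tx ty self[OF uV] by (simp add: tour_length_def)
    next
      case (Cons a as')
      have "a \<in> set as" by (simp add: Cons)
      then have aV: "a \<in> V" using sub(1) by (auto simp: xs as_def)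
      have "tour_length h ?zs = h u v + walk_length h ((v # bs) @ [a]) + walk_length h (a # as' @ [u])"
        using walk_length_append[of h "v # bs" a "as' @ [u]"] Cons by (simp add: tour_length_def)
      moreover have "tour_length h xs = h u a + walk_length h (a # as' @ [u])"
        using tx Cons by simp
      ultimately show ?thesis
        using redirect[OF aV] ty tri[OF vV uV aV] by simp
    qed
  qed
qed

section \<open>A cheap tour along a minimum spanning tree\<close>

text \<open>Abstracts hitting times scaled so that the commute time along an edge is at most the
  degree of either end. As \<open>h\<close> need not be symmetric, only its symmetrization serves as
  edge length.\<close>

locale degree_bounded_edges =
  fixes V :: "'a set" and E :: "'a \<Rightarrow> 'a \<Rightarrow> bool" and h :: "'a \<Rightarrow> 'a \<Rightarrow> real"
  assumes graph: "simple_graph V E" and conn: "connected_graph V E"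
    and h_nonneg: "u \<in> V \<Longrightarrow> v \<in> V \<Longrightarrow> h u v \<ge> 0"
    and h_self: "u \<in> V \<Longrightarrow> h u u = 0"
    and h_tri: "u \<in> V \<Longrightarrow> v \<in> V \<Longrightarrow> w \<in> V \<Longrightarrow> h u w \<le> h u v + h v w"
    and h_edge: "E u v \<Longrightarrow> h u v + h v u \<le> real (deg V E u)"
begin

section \<open>Budgets as functions of the threshold\<close>

definition edge_len :: "'a \<Rightarrow> 'a \<Rightarrow> real" where
  "edge_len u v = h u v + h v u"

abbreviation N :: "'a \<Rightarrow> 'a set" where "N \<equiv> nbrs V E"

abbreviation d :: "'a \<Rightarrow> real" where "d x \<equiv> real (deg V E x)"

definition max_nbr_deg :: "'a \<Rightarrow> real" where
  "max_nbr_deg x = Max (d ` N x)"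

text \<open>The integral over [0, r] of a spending rate: 1/\<open>d x\<close> up to
  \<open>d x\<close>, then 1/\<open>max_nbr_deg x\<close> up to \<open>max_nbr_deg x\<close>. Each
  phase contributes at most 1.\<close>

definition deg_budget :: "'a \<Rightarrow> real \<Rightarrow> real" where
  "deg_budget x r = min r (d x) / d x + max 0 (min r (max_nbr_deg x) - d x) / max_nbr_deg x"

text \<open>The integral over t in [0, r] of the fraction of edges at \<open>x\<close> that are
  longer than t.\<close>

definition len_budget :: "'a \<Rightarrow> real \<Rightarrow> real" where
  "len_budget x r = (\<Sum>u\<in>N x. min r (edge_len x u)) / d x"

definition budget :: "'a \<Rightarrow> real \<Rightarrow> real" where
  "budget x r = deg_budget x r + len_budget x r"

lemma finV: "finite V"
  using graph by (simp add: simple_graph_def)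

lemma E_V: "E u v \<Longrightarrow> u \<in> V" "E u v \<Longrightarrow> v \<in> V"
  using graph by (auto simp: simple_graph_def)

lemma E_sym: "E u v \<Longrightarrow> E v u"
  using graph by (auto simp: simple_graph_def)

lemma finN: "finite (N x)"
  using finV by (simp add: nbrs_def)

lemma N_iff: "u \<in> N x \<longleftrightarrow> E x u"
  using E_V by (auto simp: nbrs_def)

lemma edge_len_nonneg: "E u v \<Longrightarrow> edge_len u v \<ge> 0"
  using E_V h_nonneg by (simp add: edge_len_def)

lemma edge_len_le: "E u v \<Longrightarrow> edge_len u v \<le> d u"
  using h_edge by (simp add: edge_len_def)

lemma d_pos: "E u v \<Longrightarrow> d u > 0"
  using N_iff[of v u] finN[of u] by (auto simp: deg_def card_gt_0_iff)

lemma max_nbr_deg_ge: "E x u \<Longrightarrow> d u \<le> max_nbr_deg x"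
  unfolding max_nbr_deg_def using finN N_iff by (intro Max_ge) auto

lemma max_nbr_deg_nonneg: "E x u \<Longrightarrow> 0 \<le> max_nbr_deg x"
  using max_nbr_deg_ge[of x u] of_nat_0_le_iff[of "deg V E u"] by linarith

lemma deg_budget_mono: "E x u \<Longrightarrow> r \<le> s \<Longrightarrow> deg_budget x r \<le> deg_budget x s"
  unfolding deg_budget_def using max_nbr_deg_nonneg
  by (intro add_mono divide_right_mono) auto

lemma len_budget_mono: "r \<le> s \<Longrightarrow> len_budget x r \<le> len_budget x s"
  unfolding len_budget_def by (intro divide_right_mono sum_mono) auto

lemma deg_budget_le: "E x u \<Longrightarrow> deg_budget x r \<le> 2"
proof -
  assume e: "E x u"
  have "min r (d x) / d x \<le> 1" using d_pos[OF e] by (simp add: divide_le_eq_1)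
  moreover have "max 0 (min r (max_nbr_deg x) - d x) / max_nbr_deg x \<le> 1"
    using max_nbr_deg_nonneg[OF e] d_pos[OF e] by (auto simp: divide_le_eq_1)
  ultimately show ?thesis by (simp add: deg_budget_def)
qed

lemma len_budget_le: "len_budget x r \<le> (\<Sum>u\<in>N x. edge_len x u) / d x"
  unfolding len_budget_def by (intro divide_right_mono sum_mono) auto

section \<open>Every component pays for raising the threshold\<close>

lemma leaving_edge:
  assumes "K \<subseteq> V" "K \<noteq> {}" "K \<noteq> V"
  obtains x y where "x \<in> K" "y \<notin> K" "E x y"
proof -
  obtain a b where a: "a \<in> K" and b: "b \<in> V" "b \<notin> K" using assms by blast
  have "E\<^sup>*\<^sup>* a b" using conn a b assms by (auto simp: connected_graph_def)
  then have "b \<notin> K \<Longrightarrow> \<exists>x\<in>K. \<exists>y. y \<notin> K \<and> E x y"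
    by (induction rule: rtranclp_induct) (use a in auto)
  then show ?thesis using b that by blast
qed

text \<open>The neighbourhood of a vertex \<open>v\<close> of maximal degree in \<open>K\<close> pays: neighbours outside \<open>K\<close>
  through the long edges at \<open>v\<close>, neighbours inside \<open>K\<close> through their degree budget. For the
  latter, a neighbour \<open>x\<close> with \<open>d x < s\<close> has no edge leaving \<open>K\<close>, so that \<open>d v\<close> is its
  maximal neighbour degree.\<close>

lemma budget_growth:
  assumes KV: "K \<subseteq> V" and ne: "K \<noteq> {}" "K \<noteq> V" and r: "0 \<le> r" "r \<le> s"
    and leave: "\<And>x y. x \<in> K \<Longrightarrow> y \<notin> K \<Longrightarrow> E x y \<Longrightarrow> s \<le> edge_len x y"
  shows "s - r \<le> (\<Sum>x\<in>K. budget x s - budget x r)"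
proof -
  have finK: "finite K" using KV finV finite_subset by blast
  obtain x0 y0 where xy0: "x0 \<in> K" "y0 \<notin> K" "E x0 y0" using leaving_edge KV ne by blast
  obtain v where vK: "v \<in> K" and vmax: "\<And>x. x \<in> K \<Longrightarrow> d x \<le> d v"
  proof -
    have "Max (d ` K) \<in> d ` K" using finK ne by (intro Max_in) auto
    then obtain v where "v \<in> K" "Max (d ` K) = d v" by blast
    then show ?thesis using that[of v] Max_ge[of "d ` K"] finK by force
  qed
  \<comment> \<open>An edge leaving \<open>K\<close> has length at least \<open>s\<close> and at
    most the degree of its end in \<open>K\<close>.\<close>
  have s_le: "s \<le> d v"
    using leave[OF xy0] edge_len_le[OF xy0(3)] vmax[OF xy0(1)] by linarith
  have dv: "d v > 0" using d_pos[OF xy0(3)] vmax[OF xy0(1)] by linarith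
  have edge_at: "\<exists>u. E x u" if "x \<in> K" for x
  proof -
    have "{x} \<noteq> V" using xy0 E_V by blast
    then show ?thesis using leaving_edge[of "{x}"] that KV by blast
  qed
  have inner: "(s - r) / d v \<le> deg_budget x s - deg_budget x r" if x: "x \<in> N v \<inter> K" for x
  proof -
    have e: "E x v" using x N_iff E_sym by blast
    have dx: "d x > 0" by (rule d_pos[OF e])
    have dxv: "d x \<le> d v" using x vmax by blast
    show ?thesis
    proof (cases "s \<le> d x")
      case True
      \<comment> \<open>The whole interval lies in the first phase, whose rate 1/\<open>d x\<close>
        is at least 1/\<open>d v\<close>.\<close>
      have "(s - r) / d v \<le> (s - r) / d x" using r dx dxv by (intro divide_left_mono) auto
      moreover have "max 0 (min r (max_nbr_deg x) - d x) / max_nbr_deg x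
          \<le> max 0 (min s (max_nbr_deg x) - d x) / max_nbr_deg x"
        using r max_nbr_deg_nonneg[OF e] by (intro divide_right_mono) auto
      ultimately show ?thesis using True r by (simp add: deg_budget_def diff_divide_distrib)
    next
      case False
      have "N x \<subseteq> K"
      proof
        fix y assume "y \<in> N x"
        then show "y \<in> K"
          using leave[of x y] edge_len_le[of x y] x False by (force simp: N_iff)
      qed
      then have "max_nbr_deg x \<le> d v"
        unfolding max_nbr_deg_def using finN e N_iff vmax by (subst Max_le_iff) auto
      then have D: "max_nbr_deg x = d v" using max_nbr_deg_ge[OF e] by simp
      show ?thesis
      proof (cases "r \<le> d x")
        case True
        \<comment> \<open>The interval straddles \<open>d x\<close>; beyond it the rate is exactly
          1/\<open>d v\<close>, and \<open>s_le\<close> keeps \<open>s\<close> below the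
          cap.\<close>
        have "(d x - r) / d v \<le> (d x - r) / d x" using True dx dxv by (intro divide_left_mono) auto
        then show ?thesis using True False s_le dx
          by (simp add: deg_budget_def D diff_divide_distrib)
      next
        case rx: False
        then show ?thesis using False s_le r by (simp add: deg_budget_def D diff_divide_distrib)
      qed
    qed
  qed
  have outer: "real (card (N v - K)) * (s - r) / d v \<le> len_budget v s - len_budget v r"
  proof -
    have "real (card (N v - K)) * (s - r)
        = (\<Sum>u\<in>N v - K. min s (edge_len v u) - min r (edge_len v u))"
    proof -
      have "min s (edge_len v u) - min r (edge_len v u) = s - r" if "u \<in> N v - K" for u
        using that leave[of v u] vK r by (auto simp: N_iff)
      then show ?thesis by simp
    qed
    also have "\<dots> \<le> (\<Sum>u\<in>N v. min s (edge_len v u) - min r (edge_len v u))"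
      using r finN by (intro sum_mono2) auto
    finally show ?thesis
      using dv by (simp add: len_budget_def sum_subtractf divide_right_mono flip: diff_divide_distrib)
  qed
  \<comment> \<open>The growth is split into equal shares, one per neighbour of
    \<open>v\<close>.\<close>
  have "s - r = real (card (N v)) * ((s - r) / d v)"
    using dv by (simp add: deg_def)
  also have "\<dots> = (\<Sum>x\<in>N v \<inter> K. (s - r) / d v) + real (card (N v - K)) * (s - r) / d v"
    using card_Int_Diff[OF finN, of v K] by (simp add: distrib_right add_divide_distrib)
  also have "\<dots> \<le> (\<Sum>x\<in>N v \<inter> K. deg_budget x s - deg_budget x r) + (len_budget v s - len_budget v r)"
    by (intro add_mono sum_mono inner outer)
  also have "\<dots> \<le> (\<Sum>x\<in>K. deg_budget x s - deg_budget x r) + (\<Sum>x\<in>K. len_budget x s - len_budget x r)"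
  proof (rule add_mono)
    have "0 \<le> deg_budget x s - deg_budget x r" if "x \<in> K" for x
      using edge_at[OF that] deg_budget_mono r by fastforce
    then show "(\<Sum>x\<in>N v \<inter> K. deg_budget x s - deg_budget x r)
        \<le> (\<Sum>x\<in>K. deg_budget x s - deg_budget x r)"
      using finK by (intro sum_mono2) auto
    show "len_budget v s - len_budget v r \<le> (\<Sum>x\<in>K. len_budget x s - len_budget x r)"
      using len_budget_mono[OF r(2)] vK finK
      by (intro member_le_sum[of v K "\<lambda>x. len_budget x s - len_budget x r"]) auto
  qed
  finally show ?thesis by (simp add: budget_def sum.distrib[symmetric] algebra_simps)
qed

section \<open>Kruskal's algorithm on closed tours\<close>

text \<open>State of Kruskal's algorithm at threshold \<open>r\<close>, each component being stored as a closed
  tour through it. The term \<open>r * card L\<close> is the length still to be spent by the components if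
  all of them were merged at threshold \<open>r\<close>.\<close>

definition kruskal_inv :: "'a list set \<Rightarrow> real \<Rightarrow> bool" where
  "kruskal_inv L r \<longleftrightarrow> finite L \<and> (\<forall>xs\<in>L. distinct xs \<and> xs \<noteq> []) \<and>
     (\<forall>xs\<in>L. \<forall>ys\<in>L. xs \<noteq> ys \<longrightarrow> set xs \<inter> set ys = {}) \<and> (\<Union>xs\<in>L. set xs) = V \<and> 0 \<le> r \<and>
     (\<forall>xs\<in>L. \<forall>x\<in>set xs. \<forall>y. y \<notin> set xs \<longrightarrow> E x y \<longrightarrow> r \<le> edge_len x y) \<and>
     (\<Sum>xs\<in>L. tour_length h xs) + r * real (card L) \<le> (\<Sum>x\<in>V. budget x r)"

lemma kruskal_init: "kruskal_inv ((\<lambda>v. [v]) ` V) 0"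
proof -
  have "(\<Sum>xs\<in>(\<lambda>v. [v]) ` V. tour_length h xs) = 0"
    by (intro sum.neutral) (auto simp: tour_length_def h_self)
  moreover have "budget x 0 = 0" for x
  proof -
    have "max 0 (min 0 (max_nbr_deg x) - d x) = 0" by (simp add: max_def min_def)
    moreover have "(\<Sum>u\<in>N x. min 0 (edge_len x u)) = 0"
      using edge_len_nonneg by (intro sum.neutral) (auto simp: N_iff min_def)
    ultimately show ?thesis by (simp add: budget_def deg_budget_def len_budget_def)
  qed
  ultimately show ?thesis
    using finV edge_len_nonneg by (auto simp: kruskal_inv_def sum_nonneg)
qed

text \<open>Raise the threshold to the length \<open>s\<close> of a shortest edge between
  components, each of which pays for the rise by \<open>budget_growth\<close>. Merging along that
  edge then costs at most \<open>s\<close>, which is what the term \<open>s * card L\<close>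
  releases on losing one component.\<close>

lemma kruskal_step:
  assumes inv: "kruskal_inv L r" and two: "card L \<ge> 2"
  obtains L' s where "kruskal_inv L' s" "card L' < card L"
proof -
  have finL: "finite L" and dist: "\<And>xs. xs \<in> L \<Longrightarrow> distinct xs" and nonempty: "\<And>xs. xs \<in> L \<Longrightarrow> xs \<noteq> []"
    and disj: "\<And>xs ys. xs \<in> L \<Longrightarrow> ys \<in> L \<Longrightarrow> xs \<noteq> ys \<Longrightarrow> set xs \<inter> set ys = {}"
    and cover: "(\<Union>xs\<in>L. set xs) = V" and r0: "0 \<le> r"
    and leave: "\<And>xs x y. xs \<in> L \<Longrightarrow> x \<in> set xs \<Longrightarrow> y \<notin> set xs \<Longrightarrow> E x y \<Longrightarrow> r \<le> edge_len x y"
    and cost: "(\<Sum>xs\<in>L. tour_length h xs) + r * real (card L) \<le> (\<Sum>x\<in>V. budget x r)"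
    using inv unfolding kruskal_inv_def by auto
  have sub: "set xs \<subseteq> V" if "xs \<in> L" for xs unfolding cover[symmetric] using that by (rule UN_upper)
  have proper: "set xs \<noteq> V" if xs: "xs \<in> L" for xs
  proof -
    have "card (L - {xs}) \<noteq> 0" using two xs finL by simp
    then have "L - {xs} \<noteq> {}" by (metis card.empty)
    then obtain ys where ys: "ys \<in> L" "xs \<noteq> ys" by blast
    have "set xs \<inter> set ys = {}" by (rule disj[OF xs ys])
    then show ?thesis using nonempty[OF ys(1)] sub[OF ys(1)] by (metis inf.absorb_iff2 set_empty)
  qed
  define F where "F = {(x, y). E x y \<and> (\<exists>xs\<in>L. x \<in> set xs \<and> y \<notin> set xs)}"
  have "F \<subseteq> V \<times> V" unfolding F_def by (auto dest: E_V)
  then have finF: "finite F" using finV by (meson finite_SigmaI finite_subset)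
  have "L \<noteq> {}" using two by (metis card.empty not_numeral_le_zero)
  then obtain xs0 where "xs0 \<in> L" by blast
  then obtain x0 y0 where "x0 \<in> set xs0" "y0 \<notin> set xs0" "E x0 y0"
    using leaving_edge[of "set xs0"] sub[of xs0] proper[of xs0] nonempty[of xs0] by (metis set_empty)
  then have "(x0, y0) \<in> F" unfolding F_def using \<open>xs0 \<in> L\<close> by blast
  then have "Min (case_prod edge_len ` F) \<in> case_prod edge_len ` F"
    using finF by (intro Min_in) auto
  then obtain e where eF: "e \<in> F" and eMin: "case_prod edge_len e = Min (case_prod edge_len ` F)"
    by (metis imageE)
  have emin: "case_prod edge_len e \<le> case_prod edge_len f" if "f \<in> F" for f
    unfolding eMin using finF that by (intro Min_le) auto
  obtain u v where e: "e = (u, v)" by (cases e)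
  define s where "s = edge_len u v"
  obtain xs where xs: "xs \<in> L" "u \<in> set xs" "v \<notin> set xs" and uv: "E u v"
    using eF unfolding F_def e by blast
  obtain ys where ys: "ys \<in> L" "v \<in> set ys" using E_V(2)[OF uv] unfolding cover[symmetric] by (rule UN_E)
  have xy: "xs \<noteq> ys" using xs ys by blast
  have rs: "r \<le> s" unfolding s_def by (rule leave[OF xs uv])
  have leave': "s \<le> edge_len x y" if "zs \<in> L" "x \<in> set zs" "y \<notin> set zs" "E x y" for zs x y
  proof -
    have "(x, y) \<in> F" unfolding F_def using that by blast
    from emin[OF this] show ?thesis by (simp add: e s_def)
  qed
  have "real (card L) * (s - r) \<le> (\<Sum>zs\<in>L. \<Sum>x\<in>set zs. budget x s - budget x r)"
  proof -
    have "s - r \<le> (\<Sum>x\<in>set zs. budget x s - budget x r)" if "zs \<in> L" for zs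
      using that sub proper nonempty r0 rs leave' by (intro budget_growth) auto
    from sum_mono[OF this] show ?thesis by simp
  qed
  \<comment> \<open>The tours partition \<open>V\<close>, so no vertex pays twice.\<close>
  also have "\<dots> = (\<Sum>x\<in>V. budget x s - budget x r)"
    unfolding cover[symmetric] using finL disj by (intro sum.UNION_disjoint[symmetric]) auto
  finally have cost': "(\<Sum>xs\<in>L. tour_length h xs) + s * real (card L) \<le> (\<Sum>x\<in>V. budget x s)"
    using cost by (simp add: sum_subtractf algebra_simps)
  obtain zs where zs: "distinct zs" "set zs = set xs \<union> set ys"
      "tour_length h zs \<le> tour_length h xs + tour_length h ys + (h u v + h v u)"
    by (rule tour_merge[OF h_tri h_self sub[OF xs(1)] sub[OF ys(1)] dist[OF xs(1)] dist[OF ys(1)]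
        disj[OF xs(1) ys(1) xy] xs(2) ys(2)])
  define M where "M = L - {xs, ys}"
  have finM: "finite M" using finL by (simp add: M_def)
  have M_sub: "M \<subseteq> L" by (auto simp: M_def)
  have disjM: "set zs \<inter> set ws = {}" if "ws \<in> M" for ws
    using that disj[OF xs(1), of ws] disj[OF ys(1), of ws] by (auto simp: M_def zs)
  have zM: "zs \<notin> M" using disjM[of zs] zs(2) xs(2) by auto
  have L: "L = insert xs (insert ys M)" using xs ys by (auto simp: M_def)
  have cardL: "card L = card M + 2" unfolding L using finM xy by (simp add: M_def)
  have sumL: "(\<Sum>xs\<in>L. tour_length h xs) = tour_length h xs + tour_length h ys + (\<Sum>xs\<in>M. tour_length h xs)"
    unfolding L using finM xy by (simp add: M_def)
  have "kruskal_inv (insert zs M) s"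
    unfolding kruskal_inv_def
  proof (intro conjI)
    show "\<forall>ws\<in>insert zs M. distinct ws \<and> ws \<noteq> []"
      using zs xs(2) M_sub dist nonempty by auto
    show "\<forall>as\<in>insert zs M. \<forall>bs\<in>insert zs M. as \<noteq> bs \<longrightarrow> set as \<inter> set bs = {}"
    proof (intro ballI impI)
      fix as bs assume "as \<in> insert zs M" "bs \<in> insert zs M" "as \<noteq> bs"
      then consider "as = zs" "bs \<in> M" | "bs = zs" "as \<in> M" | "as \<in> L" "bs \<in> L" "as \<noteq> bs"
        using M_sub by blast
      then show "set as \<inter> set bs = {}"
        using disjM[of as] disjM[of bs] disj[of as bs] by cases (simp_all add: Int_commute)
    qed
    show "(\<Union>ws\<in>insert zs M. set ws) = V"
      unfolding cover[symmetric] L by (auto simp: zs)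
    show "\<forall>ws\<in>insert zs M. \<forall>x\<in>set ws. \<forall>y. y \<notin> set ws \<longrightarrow> E x y \<longrightarrow> s \<le> edge_len x y"
      using leave' xs(1) ys(1) M_sub by (auto simp: zs)
    show "(\<Sum>ws\<in>insert zs M. tour_length h ws) + s * real (card (insert zs M)) \<le> (\<Sum>x\<in>V. budget x s)"
      using cost' zs(3) finM zM by (simp add: cardL sumL s_def edge_len_def algebra_simps)
  qed (use finM r0 rs in auto)
  then show ?thesis using that[of "insert zs M" s] finM zM cardL by simp
qed

text \<open>Merge until one tour is left, then drop the nonnegative term \<open>r * card L\<close>
  of the invariant.\<close>

lemma kruskal_tour:
  assumes "kruskal_inv L r"
  shows "\<exists>xs s. distinct xs \<and> set xs = V \<and> tour_length h xs \<le> (\<Sum>x\<in>V. budget x s)"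
  using assms
proof (induction "card L" arbitrary: L r rule: less_induct)
  case less
  show ?case
  proof (cases "card L \<ge> 2")
    case True
    obtain L' s where "kruskal_inv L' s" "card L' < card L"
      using kruskal_step[OF less.prems True] .
    then show ?thesis using less.hyps by blast
  next
    case False
    have "L \<noteq> {}" "finite L"
      using less.prems conn by (auto simp: kruskal_inv_def connected_graph_def)
    with False have "card L = 1" by (metis One_nat_def Suc_1 card_0_eq less_2_cases not_le)
    then obtain xs where "L = {xs}" by (auto simp: card_1_singleton_iff)
    then show ?thesis using less.prems
      by (intro exI[of _ xs] exI[of _ r]) (auto simp: kruskal_inv_def)
  qed
qed

text \<open>The budgets are bounded uniformly in the final threshold. Two vertices guarantee that
  each vertex has a neighbour, hence positive degree.\<close>

theorem short_tour:
  assumes "card V \<ge> 2"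
  shows "\<exists>xs. distinct xs \<and> set xs = V \<and>
    tour_length h xs \<le> 2 * real (card V) + (\<Sum>x\<in>V. (\<Sum>u\<in>nbrs V E x. h x u + h u x) / real (deg V E x))"
proof -
  obtain xs s where xs: "distinct xs" "set xs = V" and "tour_length h xs \<le> (\<Sum>x\<in>V. budget x s)"
    using kruskal_tour[OF kruskal_init] by blast
  note this(3)
  also have "(\<Sum>x\<in>V. budget x s) \<le> (\<Sum>x\<in>V. 2 + (\<Sum>u\<in>N x. edge_len x u) / d x)"
  proof (rule sum_mono)
    fix x assume "x \<in> V"
    moreover have "{x} \<noteq> V" using assms by auto
    ultimately obtain u where "E x u" using leaving_edge[of "{x}"] by blast
    then show "budget x s \<le> 2 + (\<Sum>u\<in>N x. edge_len x u) / d x"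
      unfolding budget_def by (intro add_mono deg_budget_le len_budget_le)
  qed
  finally show ?thesis using xs by (auto simp: sum.distrib edge_len_def)
qed

end

section \<open>The minimum degree conductance\<close>

lemma cyclic_cover_time_le:
  assumes "finite V" "distinct xs" "set xs = V"
  shows "cyclic_cover_time V P \<le> cyclic_sum V P xs"
proof -
  have "finite {xs. distinct xs \<and> set xs = V}"
    by (rule finite_subset[OF _ finite_subset_distinct[OF assms(1)]]) auto
  then have "finite {cyclic_sum V P xs | xs. distinct xs \<and> set xs = V}"
    by (simp add: setcompr_eq_image)
  then show ?thesis
    unfolding cyclic_cover_time_def using assms by (intro Min_le) auto
qed

theorem theorem1:
  fixes V :: "'a set" and E :: "'a \<Rightarrow> 'a \<Rightarrow> bool"
  assumes "simple_graph V E" and "connected_graph V E"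
  shows "cyclic_cover_time V (rw_trans V E (min_deg_conductance V E))
           \<le> 18 * real (card V) ^ 2"
proof -
  define c where "c = min_deg_conductance V E"
  let ?d = "\<lambda>x. real (deg V E x)"
  have d_pos: "?d u > 0" if "E u v" for u v
    using that assms(1) by (auto simp: deg_def nbrs_def simple_graph_def card_gt_0_iff)
  have E_sym: "E v u" if "E u v" for u v
    using that assms(1) by (auto simp: simple_graph_def)
  have c_eq: "c u v = 1 / min (?d u) (?d v)" for u v
    by (simp add: c_def min_deg_conductance_def of_nat_min)
  have c_pos: "c u v > 0" if "E u v" for u v
    using d_pos[OF that] d_pos[OF E_sym[OF that]] by (simp add: c_eq)
  interpret conductance_network V E c
    by unfold_locales (use assms c_pos in \<open>auto simp: c_eq min.commute\<close>)
  let ?n = "real (card V)"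
  obtain xs where xs: "distinct xs" "set xs = V" and cost: "cyclic_sum V P xs \<le> 12 * ?n ^ 2"
  proof (cases "card V \<ge> 2")
    \<comment> \<open>On a single vertex \<open>total_strength\<close> is 0 and cannot be scaled
      away; the only tour costs 0.\<close>
    case False
    have "V \<noteq> {}" using assms(2) by (simp add: connected_graph_def)
    then have "card V = 1" using False finV by (metis One_nat_def Suc_1 card_0_eq less_2_cases not_le)
    then obtain v where "V = {v}" by (auto simp: card_1_singleton_iff)
    moreover have "cyclic_sum V P [v] = 0" by (simp add: cyclic_sum_def H_self)
    ultimately show ?thesis by (intro that[of "[v]"]) auto
  next
    case True
    let ?S = "total_strength"
    have nb: "(\<Sum>u\<in>nbrs V E v. f u) = (\<Sum>u\<in>V. if E v u then f u else 0)" for f :: "'a \<Rightarrow> real" and v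
      by (simp add: nbrs_def sum.inter_filter finV)
    have avg: "(\<Sum>u\<in>nbrs V E v. 1 / ?d v) \<le> 1" for v
      by (simp add: deg_def)
    have S_le: "?S \<le> 2 * ?n"
    proof -
      \<comment> \<open>1/min(a, b) is at most 1/a + 1/b; either sum then gives each vertex a total
        of at most 1.\<close>
      have "?S \<le> (\<Sum>v\<in>V. (\<Sum>u\<in>nbrs V E v. 1 / ?d v) + (\<Sum>u\<in>nbrs V E v. 1 / ?d u))"
        unfolding total_strength_def strength_eq sum.distrib[symmetric]
        by (intro sum_mono) (auto simp: c_eq min_def)
      also have "\<dots> = (\<Sum>v\<in>V. \<Sum>u\<in>nbrs V E v. 1 / ?d v) + (\<Sum>v\<in>V. \<Sum>u\<in>nbrs V E v. 1 / ?d u)"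
        by (rule sum.distrib)
      also have "(\<Sum>v\<in>V. \<Sum>u\<in>nbrs V E v. 1 / ?d u) = (\<Sum>u\<in>V. \<Sum>v\<in>nbrs V E u. 1 / ?d u)"
        unfolding nb by (subst sum.swap) (intro sum.cong, auto dest: E_sym)
      finally show ?thesis using sum_mono[of V "\<lambda>v. \<Sum>u\<in>nbrs V E v. 1 / ?d v" "\<lambda>_. 1"] avg by simp
    qed
    have S_pos: "?S > 0"
    proof -
      obtain a b where ab: "a \<in> V" "b \<in> V" "a \<noteq> b"
        using True by (metis card_le_Suc0_iff_eq finV not_less_eq_eq numeral_2_eq_2)
      then have "E\<^sup>*\<^sup>* a b" using assms(2) by (auto simp: connected_graph_def)
      then obtain y where "E a y" using ab by (meson converse_rtranclpE)
      then have "0 < strength a" by (rule strength_pos)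
      also have "\<dots> \<le> ?S"
        unfolding total_strength_def using ab finV by (intro member_le_sum) (auto simp: strength_nonneg)
      finally show ?thesis .
    qed
    \<comment> \<open>With this scaling, \<open>H_edge\<close> in both directions bounds the commute
      time along an edge by the smaller degree.\<close>
    define a where "a = 1 / (2 * ?S)"
    have a: "a > 0" "2 * ?S * a = 1" using S_pos by (simp_all add: a_def)
    interpret D: degree_bounded_edges V E "\<lambda>u v. a * H u v"
    proof
      show "a * H u w \<le> a * H u v + a * H v w" if "u \<in> V" "v \<in> V" "w \<in> V" for u v w
        using H_triangle[OF that] a by (simp flip: distrib_left)
      show "a * H u v + a * H v u \<le> ?d u" if e: "E u v" for u v
      proof -
        have "c u v * (H u v + H v u) \<le> 2 * ?S"
          using H_edge[OF e] H_edge[OF E_sym[OF e]] by (simp add: c_sym[of v u] distrib_left)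
        then have "H u v + H v u \<le> 2 * ?S / c u v"
          using c_pos[OF e] by (simp add: field_simps)
        also have "\<dots> = 2 * ?S * min (?d u) (?d v)" by (simp add: c_eq)
        also have "\<dots> \<le> 2 * ?S * ?d u" using S_pos by (intro mult_left_mono) auto
        finally show ?thesis using S_pos by (simp add: a_def field_simps)
      qed
    qed (use assms a H_nonneg H_self in auto)
    obtain xs where xs: "distinct xs" "set xs = V"
      and "tour_length (\<lambda>u v. a * H u v) xs
        \<le> 2 * ?n + (\<Sum>x\<in>V. (\<Sum>u\<in>nbrs V E x. a * H x u + a * H u x) / ?d x)"
      using D.short_tour[OF True] by blast
    note this(3)
    \<comment> \<open>As 1/\<open>?d x\<close> is at most \<open>c x u\<close>, the length budgets
      are dominated by the scaled Foster sum, which is at most \<open>?n\<close>.\<close>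
    also have "(\<Sum>x\<in>V. (\<Sum>u\<in>nbrs V E x. a * H x u + a * H u x) / ?d x)
        \<le> (\<Sum>x\<in>V. \<Sum>u\<in>nbrs V E x. a * (c x u * (H x u + H u x)))"
      unfolding sum_divide_distrib
    proof (intro sum_mono)
      fix x u assume "x \<in> V" "u \<in> nbrs V E x"
      then have xu: "x \<in> V" "u \<in> V" "E x u" by (auto simp: nbrs_def)
      have "1 / ?d x \<le> c x u"
        using d_pos[OF xu(3)] d_pos[OF E_sym[OF xu(3)]] by (auto simp: c_eq intro!: divide_left_mono)
      then have "1 / ?d x * (a * (H x u + H u x)) \<le> c x u * (a * (H x u + H u x))"
        using a H_nonneg xu by (intro mult_right_mono) auto
      then show "(a * H x u + a * H u x) / ?d x \<le> a * (c x u * (H x u + H u x))"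
        by (simp add: algebra_simps add_divide_distrib)
    qed
    also have "\<dots> \<le> a * (2 * ?S * ?n)"
      unfolding sum_distrib_left[symmetric] using a Foster by (intro mult_left_mono) auto
    also have "\<dots> = ?n" using a(2) by (simp add: algebra_simps)
    finally have "a * tour_length H xs \<le> 3 * ?n"
      by (simp add: tour_length_def walk_length_scale)
    then have "2 * ?S * (a * tour_length H xs) \<le> 2 * ?S * (3 * ?n)"
      using S_pos by (intro mult_left_mono) auto
    then have "tour_length H xs \<le> 2 * ?S * (3 * ?n)"
      using a(2) by (simp add: mult.assoc[symmetric])
    \<comment> \<open>One factor \<open>?n\<close> comes from \<open>S_le\<close>, the other from
      the scaled tour: \<open>2 * ?n\<close> for degree budgets and \<open>?n\<close> for length
      budgets.\<close>
    also have "\<dots> \<le> 2 * (2 * ?n) * (3 * ?n)"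
      using S_le by (intro mult_right_mono) auto
    finally have "tour_length H xs \<le> 12 * ?n ^ 2" by (simp add: power2_eq_square)
    moreover have "xs \<noteq> []" using xs True by auto
    ultimately show ?thesis using xs by (intro that) (auto simp: cyclic_sum_eq_tour_length)
  qed
  have "cyclic_cover_time V P \<le> 12 * ?n ^ 2"
    using cyclic_cover_time_le[OF finV xs, of P] cost by linarith
  also have "\<dots> \<le> 18 * ?n ^ 2" by simp
  finally show ?thesis by (simp add: c_def)
qed

end
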